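(* Let $\Sigma$ be a finite alphabet. For any $\delta>0$, $t,s\in\mathbb{N}$ and numbers $0<\rho_{i,j}(\sigma)\le1$ ($i=1,\dots,t$, $j=1,\dots,s$, $\sigma\in\Sigma$) there is $\varepsilon>0$ such that the following holds. Let $\mathcal{B}=\{B_{i,j}\}$ be a block partition of a $2$-dimensional matrix $A$ over $\Sigma$ into blocks $B_{i,j}$ of sizes $m_i\times n_j$, $i=1,\dots,t$, $j=1,\dots,s$, such that every $B_{i,j}$ is $\varepsilon$-regular and has density of each symbol $\sigma$ equal to $\rho_{i,j}(\sigma)$. Then for every $t\times s$ matrix $C=(c_{i,j})$ over $\Sigma$, the number of submatrices $C$ in $A$ is at least $$(1-\delta)\prod_{i=1}^t m_i\prod_{j=1}^s n_j\prod_{i=1}^t\prod_{j=1}^s\rho_{i,j}(c_{i,j}).$$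
   Context: A $2$-dimensional matrix over $\Sigma$ of sizes $m\times n$ is an $m\times n$ array with entries in $\Sigma$. A block is a submatrix (a choice of a set of rows and a set of columns). For a block $X$, $|X|$ is its number of entries and $\rho_\sigma(X)$ is the fraction of its entries equal to $\sigma$. A matrix $X$ of sizes $n^1\times n^2$ is $\varepsilon$-regular if for every $\sigma\in\Sigma$ and every block $Y$ of sizes $m^1\times m^2$ with $m^1\ge\varepsilon n^1$, $m^2\ge\varepsilon n^2$, $|\rho_\sigma(Y)-\rho_\sigma(X)|\le\varepsilon$. A block partition of $A$ into blocks $B_{i,j}$ of sizes $m_i\times n_j$ is given by partitioning the rows into sets $R_1,\dots,R_t$ with $|R_i|=m_i$ and the columns into sets $S_1,\dots,S_s$ with $|S_j|=n_j$, $B_{i,j}$ being the submatrix on $R_i\times S_j$. The number of submatrices $C$ in $A$ means the number of distinct submatrices of $A$ (choices of $t$ rows and $s$ columns) which can be obtained from $C$ by permutations of rows and columns. *)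

theory Defs
  imports
    Complex_Main
    "HOL-Library.Disjoint_Sets"
    "HOL-Combinatorics.Permutations"
    "Jordan_Normal_Form.Matrix"
    "Jordan_Normal_Form.DL_Submatrix"
begin

definition density :: "'a \<Rightarrow> 'a mat \<Rightarrow> real" where
  "density \<sigma> X =
     real (card {(i, j). i < dim_row X \<and> j < dim_col X \<and> X $$ (i, j) = \<sigma>})
       / real (dim_row X * dim_col X)"

definition eps_regular :: "real \<Rightarrow> 'a mat \<Rightarrow> bool" where
  "eps_regular \<epsilon> X \<longleftrightarrow>
     (\<forall>\<sigma> I J. I \<subseteq> {..<dim_row X} \<longrightarrow> J \<subseteq> {..<dim_col X} \<longrightarrow>
        real (card I) \<ge> \<epsilon> * real (dim_row X) \<longrightarrow>
        real (card J) \<ge> \<epsilon> * real (dim_col X) \<longrightarrow>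
        \<bar>density \<sigma> (submatrix X I J) - density \<sigma> X\<bar> \<le> \<epsilon>)"

text \<open>The parts are arbitrary nonempty sets of rows (columns), not necessarily intervals.
  Since \<^const>\<open>partition_on\<close> speaks about an unindexed family, injectivity is needed to
  make the indexed family have exactly \<open>t\<close> (\<open>s\<close>) parts. Indices start at \<open>0\<close>; the block
  with index \<open>(i, j)\<close> is \<open>submatrix A (R i) (S j)\<close>.\<close>

definition block_partition ::
  "'a mat \<Rightarrow> nat \<Rightarrow> nat \<Rightarrow> (nat \<Rightarrow> nat set) \<Rightarrow> (nat \<Rightarrow> nat set) \<Rightarrow> bool" where
  "block_partition A t s R S \<longleftrightarrow>
     partition_on {..<dim_row A} (R ` {..<t}) \<and> inj_on R {..<t} \<and>
     partition_on {..<dim_col A} (S ` {..<s}) \<and> inj_on S {..<s}"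

definition permuted_mat :: "'a mat \<Rightarrow> 'a mat \<Rightarrow> bool" where
  "permuted_mat C X \<longleftrightarrow>
     (\<exists>p q. p permutes {..<dim_row C} \<and> q permutes {..<dim_col C} \<and>
        X = mat (dim_row C) (dim_col C) (\<lambda>(i, j). C $$ (p i, q j)))"

text \<open>Submatrices are counted as choices of rows and columns, not by their contents.\<close>

definition num_submatrices :: "'a mat \<Rightarrow> 'a mat \<Rightarrow> nat" where
  "num_submatrices C A =
     card {(I, J). I \<subseteq> {..<dim_row A} \<and> J \<subseteq> {..<dim_col A} \<and>
        card I = dim_row C \<and> card J = dim_col C \<and> permuted_mat C (submatrix A I J)}"

end

theory Submission
  imports Defs
begin

text \<open>
  Fix a symbol for each pair \<open>(i, j)\<close> and view the entries of \<open>A\<close> carrying it as a bipartite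
  graph between \<open>R\<^sub>i\<close> and \<open>S\<^sub>j\<close>. Regularity says that this graph deviates from its density by at
  most \<open>\<epsilon> |R\<^sub>i| |S\<^sub>j|\<close> in cut norm, so replacing the \<open>ts\<close> graphs one at a time by their densities
  shows that the number of transversals of rows and columns reading off \<open>C\<close> differs from its
  expected value by at most \<open>ts \<epsilon> \<Prod>m\<^sub>i \<Prod>n\<^sub>j\<close>. Distinct transversals pick distinct sets of rows
  and columns because the parts are disjoint.
\<close>

subsection \<open>Counting in the cut norm\<close>

lemma sum_PiE_insert:
  fixes h :: "('i \<Rightarrow> 'b) \<Rightarrow> 'c::comm_monoid_add"
  assumes "a \<notin> I"
  shows "(\<Sum>f\<in>PiE (insert a I) R. h f) = (\<Sum>x\<in>R a. \<Sum>f\<in>PiE I R. h (f(a := x)))"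
  using assms
  unfolding PiE_insert_eq sum.cartesian_product
  by (subst sum.reindex[OF inj_combinator[OF assms]]) (simp add: case_prod_unfold)

text \<open>With all coordinates but \<open>f a\<close> and \<open>g b\<close> fixed, the constraints in \<open>E\<close> cut out a
  combinatorial rectangle in \<open>R a \<times> S b\<close>, to which the cut norm bound applies.\<close>

lemma edge_replacement_error:
  fixes Q :: "'i \<Rightarrow> 'j \<Rightarrow> 'b \<Rightarrow> 'c \<Rightarrow> bool" and \<rho> :: real
  assumes fin: "finite I" "finite J" "\<And>i. i \<in> I \<Longrightarrow> finite (R i)" "\<And>j. j \<in> J \<Longrightarrow> finite (S j)"
    and ab: "a \<in> I" "b \<in> J" "(a, b) \<notin> E"
    and cut: "\<And>X Y. X \<subseteq> R a \<Longrightarrow> Y \<subseteq> S b \<Longrightarrow>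
      \<bar>\<Sum>x\<in>X. \<Sum>y\<in>Y. of_bool (Q a b x y) - \<rho>\<bar> \<le> \<epsilon> * real (card (R a)) * real (card (S b))"
  shows "\<bar>\<Sum>f\<in>PiE I R. \<Sum>g\<in>PiE J S.
      of_bool (\<forall>(i, j)\<in>E. Q i j (f i) (g j)) * (of_bool (Q a b (f a) (g b)) - \<rho>)\<bar>
    \<le> \<epsilon> * real (card (PiE I R)) * real (card (PiE J S))"
proof -
  define I' where "I' = I - {a}"
  define J' where "J' = J - {b}"
  have I: "I = insert a I'" "a \<notin> I'" and J: "J = insert b J'" "b \<notin> J'"
    using ab by (auto simp: I'_def J'_def)
  have fin': "finite I'" "finite J'" using fin by (auto simp: I'_def J'_def)
  define H where "H f g = of_bool (\<forall>(i, j)\<in>E. Q i j (f i) (g j)) * (of_bool (Q a b (f a) (g b)) - \<rho>)"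
    for f g
  have rect: "\<bar>\<Sum>x\<in>R a. \<Sum>y\<in>S b. H (f(a := x)) (g(b := y))\<bar>
      \<le> \<epsilon> * real (card (R a)) * real (card (S b))" for f g
  proof -
    \<comment> \<open>\<open>X\<close> collects the constraints that avoid \<open>g b\<close>,
      \<open>Y\<close> those that involve it. As \<open>(a, b)\<close> is not in \<open>E\<close>,
      the latter never involve \<open>f a\<close>, so \<open>Y\<close> may read \<open>f i\<close>
      without the update. Constraints on neither coordinate go into \<open>X\<close>, which is empty
      when one of them fails.\<close>
    define X where "X = {x \<in> R a. \<forall>(i, j)\<in>E. j \<noteq> b \<longrightarrow> Q i j ((f(a := x)) i) (g j)}"
    define Y where "Y = {y \<in> S b. \<forall>(i, j)\<in>E. j = b \<longrightarrow> Q i j (f i) y}"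
    have "(\<forall>(i, j)\<in>E. Q i j ((f(a := x)) i) ((g(b := y)) j)) \<longleftrightarrow> x \<in> X \<and> y \<in> Y"
      if "x \<in> R a" "y \<in> S b" for x y
      using that ab(3) unfolding X_def Y_def by (auto split: if_splits)
    note rectangle = this
    have "(\<Sum>x\<in>R a. \<Sum>y\<in>S b. H (f(a := x)) (g(b := y)))
        = (\<Sum>x\<in>R a. \<Sum>y\<in>S b. of_bool (x \<in> X) * (of_bool (y \<in> Y) * (of_bool (Q a b x y) - \<rho>)))"
      unfolding H_def by (intro sum.cong refl) (simp add: rectangle del: fun_upd_apply add: fun_upd_same)
    also have "\<dots> = (\<Sum>x\<in>R a. of_bool (x \<in> X) * (\<Sum>y\<in>S b. of_bool (y \<in> Y) * (of_bool (Q a b x y) - \<rho>)))"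
      by (simp add: sum_distrib_left)
    also have "\<dots> = (\<Sum>x\<in>X. \<Sum>y\<in>Y. of_bool (Q a b x y) - \<rho>)"
    proof -
      have "(\<Sum>y\<in>S b. of_bool (y \<in> Y) * (of_bool (Q a b x y) - \<rho>)) = (\<Sum>y\<in>Y. of_bool (Q a b x y) - \<rho>)" for x
        using fin(4)[OF ab(2)] by (intro sum.mono_neutral_cong_right) (auto simp: Y_def)
      then have "(\<Sum>x\<in>R a. of_bool (x \<in> X) * (\<Sum>y\<in>S b. of_bool (y \<in> Y) * (of_bool (Q a b x y) - \<rho>)))
          = (\<Sum>x\<in>R a. of_bool (x \<in> X) * (\<Sum>y\<in>Y. of_bool (Q a b x y) - \<rho>))"
        by (simp only:)
      also have "\<dots> = (\<Sum>x\<in>X. \<Sum>y\<in>Y. of_bool (Q a b x y) - \<rho>)"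
        using fin(3)[OF ab(1)] by (intro sum.mono_neutral_cong_right) (auto simp: X_def)
      finally show ?thesis .
    qed
    finally show ?thesis
      using cut[of X Y] by (simp add: X_def Y_def)
  qed
  \<comment> \<open>The coordinates at \<open>a\<close> and \<open>b\<close> are split off and their
    sums moved innermost, so that \<open>rect\<close> applies to each choice of the remaining
    ones.\<close>
  have "(\<Sum>f\<in>PiE I R. \<Sum>g\<in>PiE J S. H f g)
      = (\<Sum>x\<in>R a. \<Sum>f\<in>PiE I' R. \<Sum>y\<in>S b. \<Sum>g\<in>PiE J' S. H (f(a := x)) (g(b := y)))"
    unfolding I(1) J(1) sum_PiE_insert[OF I(2)] sum_PiE_insert[OF J(2)] ..
  also have "\<dots> = (\<Sum>f\<in>PiE I' R. \<Sum>x\<in>R a. \<Sum>g\<in>PiE J' S. \<Sum>y\<in>S b. H (f(a := x)) (g(b := y)))"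
    by (subst sum.swap, intro sum.cong refl, subst sum.swap, rule refl)
  also have "\<dots> = (\<Sum>f\<in>PiE I' R. \<Sum>g\<in>PiE J' S. \<Sum>x\<in>R a. \<Sum>y\<in>S b. H (f(a := x)) (g(b := y)))"
    by (intro sum.cong refl, subst sum.swap, rule refl)
  also have "\<bar>\<dots>\<bar> \<le> (\<Sum>f\<in>PiE I' R. \<Sum>g\<in>PiE J' S. \<epsilon> * real (card (R a)) * real (card (S b)))"
    by (intro order.trans[OF sum_abs] sum_mono rect)
  also have "\<dots> = \<epsilon> * real (card (PiE I R)) * real (card (PiE J S))"
    using fin' I(2) J(2) by (simp add: I(1) J(1) card_PiE)
  finally show ?thesis by (simp add: H_def)
qed

text \<open>Induction on the set \<open>E\<close> of imposed constraints: each new edge costs one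
  cut norm error, and multiplying the earlier error by a density of at most 1 does not enlarge it,
  so the errors merely add up.\<close>

lemma counting_lemma:
  fixes Q :: "'i \<Rightarrow> 'j \<Rightarrow> 'b \<Rightarrow> 'c \<Rightarrow> bool" and \<rho> :: "'i \<Rightarrow> 'j \<Rightarrow> real"
  assumes fin: "finite I" "finite J" "\<And>i. i \<in> I \<Longrightarrow> finite (R i)" "\<And>j. j \<in> J \<Longrightarrow> finite (S j)"
    and E: "E \<subseteq> I \<times> J"
    and \<rho>: "\<And>i j. i \<in> I \<Longrightarrow> j \<in> J \<Longrightarrow> 0 \<le> \<rho> i j \<and> \<rho> i j \<le> 1"
    and cut: "\<And>i j X Y. i \<in> I \<Longrightarrow> j \<in> J \<Longrightarrow> X \<subseteq> R i \<Longrightarrow> Y \<subseteq> S j \<Longrightarrow>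
      \<bar>\<Sum>x\<in>X. \<Sum>y\<in>Y. of_bool (Q i j x y) - \<rho> i j\<bar> \<le> \<epsilon> * real (card (R i)) * real (card (S j))"
  shows "\<bar>(\<Sum>f\<in>PiE I R. \<Sum>g\<in>PiE J S. of_bool (\<forall>(i, j)\<in>E. Q i j (f i) (g j)))
      - real (card (PiE I R)) * real (card (PiE J S)) * (\<Prod>(i, j)\<in>E. \<rho> i j)\<bar>
    \<le> real (card E) * \<epsilon> * real (card (PiE I R)) * real (card (PiE J S))"
proof -
  have "finite E" using E fin(1,2) finite_subset by blast
  then show ?thesis using E
  proof (induction E rule: finite_induct)
    case empty
    then show ?case by simp
  next
    case (insert e E)
    obtain a b where e: "e = (a, b)" by (cases e)
    have ab: "a \<in> I" "b \<in> J" "(a, b) \<notin> E" using insert e by auto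
    define F where "F = real (card (PiE I R)) * real (card (PiE J S))"
    define N where "N E = (\<Sum>f\<in>PiE I R. \<Sum>g\<in>PiE J S. of_bool (\<forall>(i, j)\<in>E. Q i j (f i) (g j)) :: real)" for E
    define P where "P = (\<Prod>(i, j)\<in>E. \<rho> i j)"
    \<comment> \<open>The indicator for \<open>insert e E\<close> is the one for \<open>E\<close>
      times the indicator of the new edge, which gives exactly the sum bounded by
      \<open>edge_replacement_error\<close>.\<close>
    have "N (insert e E) - \<rho> a b * N E = (\<Sum>f\<in>PiE I R. \<Sum>g\<in>PiE J S.
      of_bool (\<forall>(i, j)\<in>E. Q i j (f i) (g j)) * (of_bool (Q a b (f a) (g b)) - \<rho> a b))"
      unfolding N_def e sum_distrib_left sum_subtractf[symmetric]
      by (intro sum.cong refl) (auto simp: algebra_simps)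
    then have 1: "\<bar>N (insert e E) - \<rho> a b * N E\<bar> \<le> \<epsilon> * F"
      using edge_replacement_error[where R=R and S=S and Q=Q and \<rho>="\<rho> a b" and \<epsilon>=\<epsilon>, OF fin ab cut[OF ab(1,2)]]
      by (simp add: F_def algebra_simps)
    have "\<bar>\<rho> a b * N E - \<rho> a b * (F * P)\<bar> = \<rho> a b * \<bar>N E - F * P\<bar>"
      using \<rho>[OF ab(1,2)] by (simp add: abs_mult flip: right_diff_distrib)
    also have "\<dots> \<le> \<bar>N E - F * P\<bar>"
      using \<rho>[OF ab(1,2)] by (intro mult_left_le_one_le) auto
    also have "\<dots> \<le> real (card E) * \<epsilon> * F"
      using insert.IH insert.prems by (simp add: N_def P_def F_def mult.assoc)
    finally have "\<bar>N (insert e E) - F * (\<rho> a b * P)\<bar> \<le> real (card E) * \<epsilon> * F + \<epsilon> * F"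
      using 1 by (simp add: algebra_simps)
    then show ?case
      using insert.hyps unfolding N_def[symmetric]
      by (simp add: e P_def F_def algebra_simps)
  qed
qed

subsection \<open>Regularity bounds the cut norm\<close>

text \<open>Links positions inside a submatrix to rows and columns of the ambient matrix. Strict
  monotonicity of \<open>pick\<close> gives injectivity, and equal cardinalities then give
  surjectivity.\<close>

lemma bij_betw_pick:
  assumes "finite I"
  shows "bij_betw (pick I) {..<card I} I"
proof -
  have "inj_on (pick I) {..<card I}"
    by (rule linorder_inj_onI') (metis lessThan_iff less_irrefl pick_mono_le)
  moreover have "pick I ` {..<card I} \<subseteq> I"
    by (auto intro: pick_in_set_le)
  ultimately show ?thesis
    using assms by (metis bij_betw_def card_image card_lessThan card_subset_eq)
qed

lemma real_card_pairs:
  assumes "finite X" "finite Y"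
  shows "real (card {(x, y). x \<in> X \<and> y \<in> Y \<and> P x y}) = (\<Sum>x\<in>X. \<Sum>y\<in>Y. of_bool (P x y))"
proof -
  have "{(x, y). x \<in> X \<and> y \<in> Y \<and> P x y} = (SIGMA x:X. {y \<in> Y. P x y})" by auto
  then show ?thesis using assms by (simp add: card_SigmaI Int_def)
qed

lemma card_pairs_image:
  assumes "inj_on f I" "inj_on g J"
  shows "card {(x, y). x \<in> f ` I \<and> y \<in> g ` J \<and> P x y} = card {(i, j). i \<in> I \<and> j \<in> J \<and> P (f i) (g j)}"
proof -
  have "{(x, y). x \<in> f ` I \<and> y \<in> g ` J \<and> P x y} = map_prod f g ` {(i, j). i \<in> I \<and> j \<in> J \<and> P (f i) (g j)}"
    by force
  moreover have "inj_on (map_prod f g) {(i, j). i \<in> I \<and> j \<in> J \<and> P (f i) (g j)}"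
    using map_prod_inj_on[OF assms] by (rule inj_on_subset) auto
  ultimately show ?thesis by (simp add: card_image)
qed

lemma dim_submatrix_subset:
  shows "I \<subseteq> {..<dim_row A} \<Longrightarrow> dim_row (submatrix A I J) = card I"
    and "J \<subseteq> {..<dim_col A} \<Longrightarrow> dim_col (submatrix A I J) = card J"
  unfolding dim_submatrix by (rule arg_cong[where f = card], auto)+

lemma submatrix_index_subset:
  assumes "I \<subseteq> {..<dim_row A}" "J \<subseteq> {..<dim_col A}" "i < card I" "j < card J"
  shows "submatrix A I J $$ (i, j) = A $$ (pick I i, pick J j)"
  using assms by (intro submatrix_index) (auto simp: dim_submatrix_subset[unfolded dim_submatrix])

text \<open>Reindexing by \<open>pick\<close> preserves the count of matching entries, so densities
  of blocks can be handled in the coordinates of \<open>A\<close>.\<close>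

lemma density_submatrix:
  assumes "I \<subseteq> {..<dim_row A}" "J \<subseteq> {..<dim_col A}"
  shows "density \<sigma> (submatrix A I J) =
    real (card {(i, j). i \<in> I \<and> j \<in> J \<and> A $$ (i, j) = \<sigma>}) / (real (card I) * real (card J))"
proof -
  have "finite I" "finite J" using assms by (auto intro: finite_subset)
  then have I: "inj_on (pick I) {..<card I}" "pick I ` {..<card I} = I"
    and J: "inj_on (pick J) {..<card J}" "pick J ` {..<card J} = J"
    using bij_betw_pick[of I] bij_betw_pick[of J] by (simp_all add: bij_betw_def)
  have "card {(i, j). i \<in> I \<and> j \<in> J \<and> A $$ (i, j) = \<sigma>}
      = card {(i, j). i < card I \<and> j < card J \<and> A $$ (pick I i, pick J j) = \<sigma>}"
    using card_pairs_image[OF I(1) J(1), of "\<lambda>i j. A $$ (i, j) = \<sigma>"] by (simp add: I(2) J(2))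
  also have "{(i, j). i < card I \<and> j < card J \<and> A $$ (pick I i, pick J j) = \<sigma>}
      = {(i, j). i < card I \<and> j < card J \<and> submatrix A I J $$ (i, j) = \<sigma>}"
    using assms by (auto simp: submatrix_index_subset)
  finally show ?thesis
    by (simp add: density_def dim_submatrix_subset assms)
qed

text \<open>If both sides of \<open>X\<close> and \<open>Y\<close> are long enough, regularity
  applies. Otherwise one side is so short that the rectangle has at most \<epsilon> |R| |S| entries,
  and the total deviation is at most the number of entries.\<close>

lemma eps_regular_cut_norm:
  assumes sub: "R \<subseteq> {..<dim_row A}" "S \<subseteq> {..<dim_col A}"
    and reg: "eps_regular \<epsilon> (submatrix A R S)" and \<rho>: "density \<sigma> (submatrix A R S) = \<rho>"
    and XY: "X \<subseteq> R" "Y \<subseteq> S"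
  shows "\<bar>\<Sum>x\<in>X. \<Sum>y\<in>Y. of_bool (A $$ (x, y) = \<sigma>) - \<rho>\<bar> \<le> \<epsilon> * real (card R) * real (card S)"
proof -
  have fin: "finite R" "finite S" using sub by (auto intro: finite_subset)
  then have finXY: "finite X" "finite Y" using XY by (auto intro: finite_subset)
  define N where "N = card {(x, y). x \<in> X \<and> y \<in> Y \<and> A $$ (x, y) = \<sigma>}"
  define M where "M = real (card X) * real (card Y)"
  have N: "(\<Sum>x\<in>X. \<Sum>y\<in>Y. of_bool (A $$ (x, y) = \<sigma>) - \<rho>) = real N - \<rho> * M"
    unfolding N_def real_card_pairs[OF finXY] M_def by (simp add: sum_subtractf mult_ac)
  have leM: "real N \<le> M"
  proof -
    have "N \<le> card (X \<times> Y)" unfolding N_def using finXY by (intro card_mono) auto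
    then show ?thesis by (simp add: M_def card_cartesian_product flip: of_nat_mult)
  qed
  \<comment> \<open>This covers empty blocks too: division by zero makes their density 0.\<close>
  have \<rho>01: "0 \<le> \<rho>" "\<rho> \<le> 1"
  proof -
    define c where "c = real (card {(x, y). x \<in> R \<and> y \<in> S \<and> A $$ (x, y) = \<sigma>})"
    define d where "d = real (card R) * real (card S)"
    have "card {(x, y). x \<in> R \<and> y \<in> S \<and> A $$ (x, y) = \<sigma>} \<le> card (R \<times> S)"
      using fin by (intro card_mono) auto
    then have "0 \<le> c" "c \<le> d"
      by (simp_all add: c_def d_def card_cartesian_product flip: of_nat_mult)
    moreover have "\<rho> = c / d"
      using \<rho> by (simp add: density_submatrix sub c_def d_def)
    ultimately show "0 \<le> \<rho>" "\<rho> \<le> 1"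
      by (auto simp: divide_le_eq_1)
  qed
  \<comment> \<open>A negative \<epsilon> would admit the empty sets of rows and columns in the
    regularity condition, which would then bound an absolute value by a negative number.\<close>
  have \<epsilon>: "0 \<le> \<epsilon>"
  proof -
    define B where "B = submatrix A R S"
    have "\<epsilon> * real (dim_row B) \<le> 0" if "\<epsilon> < 0" using that by (simp add: mult_nonpos_nonneg)
    moreover have "\<epsilon> * real (dim_col B) \<le> 0" if "\<epsilon> < 0" using that by (simp add: mult_nonpos_nonneg)
    ultimately have "\<bar>density \<sigma> (submatrix B {} {}) - density \<sigma> B\<bar> \<le> \<epsilon>" if "\<epsilon> < 0"
      using reg that unfolding eps_regular_def B_def by auto
    then show ?thesis by linarith
  qed
  have le: "card X \<le> card R" "card Y \<le> card S" using XY fin by (auto intro: card_mono)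
  have "\<bar>real N - \<rho> * M\<bar> \<le> \<epsilon> * (real (card R) * real (card S))"
  proof (cases "\<epsilon> * real (card R) \<le> real (card X) \<and> \<epsilon> * real (card S) \<le> real (card Y)")
    case False
    \<comment> \<open>Both \<open>N\<close> and \<rho> \<open>M\<close> lie between 0 and
      \<open>M\<close>, so they differ by at most \<open>M\<close>.\<close>
    have "0 \<le> \<rho> * M" "\<rho> * M \<le> M"
      using \<rho>01 by (auto simp: M_def intro: mult_left_le_one_le)
    then have "\<bar>real N - \<rho> * M\<bar> \<le> M"
      using leM by linarith
    also have "M \<le> \<epsilon> * (real (card R) * real (card S))"
    proof (cases "\<epsilon> * real (card R) \<le> real (card X)")
      case True
      then have "real (card Y) \<le> \<epsilon> * real (card S)" using False by linarith
      then have "real (card X) * real (card Y) \<le> real (card R) * (\<epsilon> * real (card S))"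
        using le by (intro mult_mono) auto
      then show ?thesis by (simp add: M_def mult_ac)
    next
      case F: False
      then have "real (card X) * real (card Y) \<le> (\<epsilon> * real (card R)) * real (card S)"
        using le \<epsilon> by (intro mult_mono) auto
      then show ?thesis by (simp add: M_def mult_ac)
    qed
    finally show ?thesis .
  next
    case True
    define B where "B = submatrix A R S"
    have dimB: "dim_row B = card R" "dim_col B = card S"
      by (simp_all add: B_def dim_submatrix_subset sub)
    \<comment> \<open>Regularity speaks of positions inside the block, so \<open>X\<close> and
      \<open>Y\<close> are pulled back along \<open>pick\<close>.\<close>
    define I where "I = {k. k < card R \<and> pick R k \<in> X}"
    define J where "J = {k. k < card S \<and> pick S k \<in> Y}"
    have I: "inj_on (pick R) I" "pick R ` I = X"
      using bij_betw_pick[OF fin(1)] XY(1) by (auto simp: I_def bij_betw_def image_iff intro: inj_on_subset)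
    have J: "inj_on (pick S) J" "pick S ` J = Y"
      using bij_betw_pick[OF fin(2)] XY(2) by (auto simp: J_def bij_betw_def image_iff intro: inj_on_subset)
    have IJsub: "I \<subseteq> {..<dim_row B}" "J \<subseteq> {..<dim_col B}" by (auto simp: I_def J_def dimB)
    have cIJ: "card I = card X" "card J = card Y" using I J card_image by metis+
    have "{(i, j). i \<in> I \<and> j \<in> J \<and> B $$ (i, j) = \<sigma>} = {(i, j). i \<in> I \<and> j \<in> J \<and> A $$ (pick R i, pick S j) = \<sigma>}"
      using sub by (auto simp: I_def J_def B_def submatrix_index_subset)
    then have "card {(i, j). i \<in> I \<and> j \<in> J \<and> B $$ (i, j) = \<sigma>} = N"
      using card_pairs_image[OF I(1) J(1), of "\<lambda>x y. A $$ (x, y) = \<sigma>"] by (simp add: I(2) J(2) N_def)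
    then have "density \<sigma> (submatrix B I J) = real N / M"
      by (simp add: density_submatrix IJsub cIJ M_def)
    then have *: "\<bar>real N / M - \<rho>\<bar> \<le> \<epsilon>"
      using reg IJsub True \<rho> unfolding eps_regular_def B_def[symmetric] dimB by (metis cIJ)
    have "0 \<le> M" "M \<le> real (card R) * real (card S)" using le by (auto simp: M_def intro: mult_mono)
    \<comment> \<open>If \<open>M = 0\<close>, the quotient is 0 by convention, but
      \<open>leM\<close> forces \<open>N = 0\<close> and the identity survives.\<close>
    have "real N - \<rho> * M = (real N / M - \<rho>) * M"
      using leM by (cases "M = 0") (auto simp: left_diff_distrib)
    then have "\<bar>real N - \<rho> * M\<bar> = \<bar>real N / M - \<rho>\<bar> * M"
      using \<open>0 \<le> M\<close> by (simp add: abs_mult)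
    also have "\<dots> \<le> \<epsilon> * (real (card R) * real (card S))"
      using * \<epsilon> \<open>0 \<le> M\<close> \<open>M \<le> _\<close> by (intro mult_mono) auto
    finally show ?thesis .
  qed
  then show ?thesis unfolding N by (simp add: mult.assoc)
qed

subsection \<open>Transversals as submatrices\<close>

text \<open>\<open>f\<close> enumerates its image in arbitrary order and \<open>pick\<close> in
  increasing order; two enumerations of one finite set differ by a permutation.\<close>

lemma pick_image_permutes:
  assumes "inj_on f {..<n::nat}"
  obtains p where "p permutes {..<n}" "\<And>k. k < n \<Longrightarrow> pick (f ` {..<n}) k = f (p k)"
proof -
  let ?I = "f ` {..<n}"
  define p where "p k = (if k < n then inv_into {..<n} f (pick ?I k) else k)" for k
  have "card ?I = n" using assms by (simp add: card_image)
  then have pick: "bij_betw (pick ?I) {..<n} ?I"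
    using bij_betw_pick[of ?I] by simp
  have "bij_betw (inv_into {..<n} f) ?I {..<n}"
    using assms by (simp add: bij_betw_inv_into inj_on_imp_bij_betw)
  from bij_betw_trans[OF pick this] have "bij_betw p {..<n} {..<n}"
    by (rule bij_betw_cong[THEN iffD1, rotated]) (auto simp: p_def)
  then have "p permutes {..<n}"
    by (rule bij_imp_permutes) (auto simp: p_def)
  moreover have "pick ?I k = f (p k)" if "k < n" for k
    using that bij_betwE[OF pick] by (simp add: p_def f_inv_into_f)
  ultimately show ?thesis by (rule that)
qed

lemma inj_on_transversal:
  assumes "disjoint_family_on R I" "f \<in> PiE I R"
  shows "inj_on f I"
proof (rule inj_onI)
  fix i k assume "i \<in> I" "k \<in> I" "f i = f k"
  moreover from this have "f i \<in> R i" "f k \<in> R k" using assms(2) PiE_mem by metis+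
  ultimately show "i = k" using disjoint_family_onD[OF assms(1), of i k] by auto
qed

text \<open>Disjointness reveals the index from which each chosen element comes, so no set of rows
  or columns arises from two transversals.\<close>

lemma inj_on_image_PiE:
  assumes "disjoint_family_on R I"
  shows "inj_on (\<lambda>f. f ` I) (PiE I R)"
proof (rule inj_onI)
  fix f g assume fg: "f \<in> PiE I R" "g \<in> PiE I R" "f ` I = g ` I"
  show "f = g"
  proof (rule PiE_ext[OF fg(1,2)])
    fix i assume i: "i \<in> I"
    then obtain k where k: "k \<in> I" "f i = g k" using fg(3) by (metis imageE imageI)
    have "f i \<in> R i" "g k \<in> R k" using fg(1,2) i k(1) by auto
    then have "k = i" using disjoint_family_onD[OF assms, of k i] i k by auto
    then show "f i = g i" using k(2) by simp
  qed
qed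

text \<open>A transversal pair need not list its rows and columns in increasing order, whereas a
  submatrix does; this is why it yields \<open>C\<close> only up to permutations. Only an inequality
  is claimed, since a permuted copy of \<open>C\<close> may also take several rows from one
  part.\<close>

lemma num_submatrices_ge_transversals:
  assumes C: "C \<in> carrier_mat t s"
    and R: "disjoint_family_on R {..<t}" "\<And>i. i < t \<Longrightarrow> R i \<subseteq> {..<dim_row A}"
    and S: "disjoint_family_on S {..<s}" "\<And>j. j < s \<Longrightarrow> S j \<subseteq> {..<dim_col A}"
  shows "card {(f, g). f \<in> PiE {..<t} R \<and> g \<in> PiE {..<s} S \<and>
    (\<forall>i<t. \<forall>j<s. A $$ (f i, g j) = C $$ (i, j))}
    \<le> num_submatrices C A"
proof -
  let ?T = "{(f, g). f \<in> PiE {..<t} R \<and> g \<in> PiE {..<s} S \<and>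
    (\<forall>i<t. \<forall>j<s. A $$ (f i, g j) = C $$ (i, j))}"
  let ?im = "map_prod (\<lambda>f. f ` {..<t}) (\<lambda>g. g ` {..<s})"
  let ?U = "{(I, J). I \<subseteq> {..<dim_row A} \<and> J \<subseteq> {..<dim_col A} \<and>
        card I = dim_row C \<and> card J = dim_col C \<and> permuted_mat C (submatrix A I J)}"
  have "inj_on ?im ?T"
    by (rule inj_on_subset[OF map_prod_inj_on[OF inj_on_image_PiE[OF R(1)] inj_on_image_PiE[OF S(1)]]]) auto
  moreover have "?im ` ?T \<subseteq> ?U"
  proof (rule image_subsetI)
    fix z assume "z \<in> ?T"
    then obtain f g where z: "z = (f, g)" and f: "f \<in> PiE {..<t} R" and g: "g \<in> PiE {..<s} S"
      and eq: "\<forall>i<t. \<forall>j<s. A $$ (f i, g j) = C $$ (i, j)"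
      by blast
    have sub: "f ` {..<t} \<subseteq> {..<dim_row A}" "g ` {..<s} \<subseteq> {..<dim_col A}"
      using f g R(2) S(2) by (auto simp: PiE_iff) blast+
    have inj: "inj_on f {..<t}" "inj_on g {..<s}"
      using inj_on_transversal R(1) S(1) f g by auto
    then have card: "card (f ` {..<t}) = t" "card (g ` {..<s}) = s"
      by (simp_all add: card_image)
    obtain p where p: "p permutes {..<t}" "\<And>k. k < t \<Longrightarrow> pick (f ` {..<t}) k = f (p k)"
      using pick_image_permutes[OF inj(1)] by blast
    obtain q where q: "q permutes {..<s}" "\<And>k. k < s \<Longrightarrow> pick (g ` {..<s}) k = g (q k)"
      using pick_image_permutes[OF inj(2)] by blast
    have "p i < t" if "i < t" for i using permutes_in_image[OF p(1), of i] that by simp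
    moreover have "q j < s" if "j < s" for j using permutes_in_image[OF q(1), of j] that by simp
    \<comment> \<open>Entry \<open>(i, j)\<close> of the submatrix is the entry of \<open>A\<close>
      at \<open>(f (p i), g (q j))\<close>, which \<open>eq\<close> turns into
      \<open>C $$ (p i, q j)\<close>.\<close>
    ultimately have "submatrix A (f ` {..<t}) (g ` {..<s}) = mat t s (\<lambda>(i, j). C $$ (p i, q j))"
      using sub card eq p(2) q(2)
      by (intro eq_matI) (auto simp: dim_submatrix_subset submatrix_index_subset)
    then have "permuted_mat C (submatrix A (f ` {..<t}) (g ` {..<s}))"
      using p(1) q(1) C unfolding permuted_mat_def by auto
    then show "?im z \<in> ?U"
      using sub card C by (auto simp: z)
  qed
  moreover have "finite ?U"
    by (rule finite_subset[of _ "Pow {..<dim_row A} \<times> Pow {..<dim_col A}"]) auto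
  ultimately show ?thesis
    unfolding num_submatrices_def by (rule card_inj_on_le)
qed

text \<open>\<open>partition_on\<close> separates distinct sets; injectivity of the indexing turns
  this into disjointness for distinct indices.\<close>

lemma block_partitionD:
  assumes "block_partition A t s R S"
  shows "disjoint_family_on R {..<t}" "\<And>i. i < t \<Longrightarrow> R i \<subseteq> {..<dim_row A}"
    and "disjoint_family_on S {..<s}" "\<And>j. j < s \<Longrightarrow> S j \<subseteq> {..<dim_col A}"
proof -
  have R: "partition_on {..<dim_row A} (R ` {..<t})" "inj_on R {..<t}"
    and S: "partition_on {..<dim_col A} (S ` {..<s})" "inj_on S {..<s}"
    using assms by (auto simp: block_partition_def)
  show "disjoint_family_on R {..<t}"
    unfolding disjoint_family_on_def
    by (intro ballI impI disjointD[OF partition_onD2[OF R(1)]]) (auto dest: inj_onD[OF R(2)])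
  show "disjoint_family_on S {..<s}"
    unfolding disjoint_family_on_def
    by (intro ballI impI disjointD[OF partition_onD2[OF S(1)]]) (auto dest: inj_onD[OF S(2)])
  show "R i \<subseteq> {..<dim_row A}" if "i < t" for i
    using partition_onD1[OF R(1)] that by blast
  show "S j \<subseteq> {..<dim_col A}" if "j < s" for j
    using partition_onD1[OF S(1)] that by blast
qed

section \<open>Choice of the regularity parameter and assembly of the bound\<close>

theorem theorem4:
  fixes \<delta> :: real and t s :: nat and \<rho> :: "nat \<Rightarrow> nat \<Rightarrow> 'a::finite \<Rightarrow> real"
  assumes "\<delta> > 0"
    and "\<And>i j \<sigma>. i < t \<Longrightarrow> j < s \<Longrightarrow> 0 < \<rho> i j \<sigma> \<and> \<rho> i j \<sigma> \<le> 1"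
  shows "\<exists>\<epsilon>>0. \<forall>(A :: 'a mat) R S.
    block_partition A t s R S \<longrightarrow>
    (\<forall>i<t. \<forall>j<s. eps_regular \<epsilon> (submatrix A (R i) (S j)) \<and>
        (\<forall>\<sigma>. density \<sigma> (submatrix A (R i) (S j)) = \<rho> i j \<sigma>)) \<longrightarrow>
    (\<forall>C \<in> carrier_mat t s.
      real (num_submatrices C A) \<ge>
        (1 - \<delta>) * (\<Prod>i<t. real (card (R i))) * (\<Prod>j<s. real (card (S j)))
          * (\<Prod>i<t. \<Prod>j<s. \<rho> i j (C $$ (i, j))))"
proof -
  \<comment> \<open>A positive lower bound for all prescribed densities, depending on neither
    \<open>A\<close> nor \<open>C\<close>; finiteness of the alphabet enters here. The extra 1 keeps
    the set nonempty when \<open>t\<close> or \<open>s\<close> is 0.\<close>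
  define r where "r = Min (insert 1 ((\<lambda>(i, j, \<sigma>). \<rho> i j \<sigma>) ` ({..<t} \<times> {..<s} \<times> UNIV)))"
  have r: "0 < r" using assms(2) unfolding r_def by (subst Min_gr_iff) auto
  have r_le: "r \<le> \<rho> i j \<sigma>" if "i < t" "j < s" for i j \<sigma>
    unfolding r_def using that by (intro Min_le) (auto simp: image_iff intro!: bexI[of _ "(i, j, \<sigma>)"])
  define K where "K = real (t * s)"
  have K: "0 \<le> K" by (simp add: K_def)
  \<comment> \<open>Chosen so that the accumulated error of \<open>K\<close> replacements is at most
    \<delta> times \<open>r ^ (t * s)\<close>, a lower bound for every product of densities. The
    summand 1 avoids dividing by zero when \<open>K = 0\<close>.\<close>
  define \<epsilon> where "\<epsilon> = \<delta> * r ^ (t * s) / (K + 1)"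
  have \<epsilon>: "\<epsilon> > 0"
    using r assms(1) K by (simp add: \<epsilon>_def)
  have "\<epsilon> * (K + 1) = \<delta> * r ^ (t * s)"
    using K by (simp add: \<epsilon>_def)
  then have K\<epsilon>: "K * \<epsilon> \<le> \<delta> * r ^ (t * s)"
    using \<epsilon> by (simp add: distrib_left mult.commute)
  show ?thesis
  proof (intro exI[of _ \<epsilon>] conjI \<epsilon> allI impI ballI)
    fix A C :: "'a mat" and R S
    assume bp: "block_partition A t s R S"
      and reg: "\<forall>i<t. \<forall>j<s. eps_regular \<epsilon> (submatrix A (R i) (S j)) \<and>
        (\<forall>\<sigma>. density \<sigma> (submatrix A (R i) (S j)) = \<rho> i j \<sigma>)"
      and C: "C \<in> carrier_mat t s"
    note bpD = block_partitionD[OF bp]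
    let ?F = "PiE {..<t} R" and ?G = "PiE {..<s} S"
    define M where "M = real (card ?F) * real (card ?G)"
    define P where "P = (\<Prod>i<t. \<Prod>j<s. \<rho> i j (C $$ (i, j)))"
    have fin: "finite (R i)" if "i < t" for i using bpD(2)[OF that] finite_subset by blast
    have fin': "finite (S j)" if "j < s" for j using bpD(4)[OF that] finite_subset by blast
    have finFG: "finite ?F" "finite ?G" using fin fin' by (auto intro: finite_PiE)
    let ?N = "\<Sum>f\<in>?F. \<Sum>g\<in>?G. of_bool (\<forall>(i, j)\<in>{..<t} \<times> {..<s}. A $$ (f i, g j) = C $$ (i, j)) :: real"
    have "\<bar>?N - real (card ?F) * real (card ?G) * (\<Prod>(i, j)\<in>{..<t} \<times> {..<s}. \<rho> i j (C $$ (i, j)))\<bar>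
      \<le> real (card ({..<t} \<times> {..<s})) * \<epsilon> * real (card ?F) * real (card ?G)"
    proof (rule counting_lemma[where Q = "\<lambda>i j x y. A $$ (x, y) = C $$ (i, j)"])
      show "\<bar>\<Sum>x\<in>X. \<Sum>y\<in>Y. of_bool (A $$ (x, y) = C $$ (i, j)) - \<rho> i j (C $$ (i, j))\<bar>
          \<le> \<epsilon> * real (card (R i)) * real (card (S j))"
        if "i \<in> {..<t}" "j \<in> {..<s}" "X \<subseteq> R i" "Y \<subseteq> S j" for i j X Y
        using that reg by (intro eps_regular_cut_norm bpD) auto
    qed (use fin fin' assms(2) in \<open>auto simp: less_imp_le\<close>)
    then have "\<bar>?N - M * P\<bar> \<le> K * \<epsilon> * M"
      by (simp add: K_def M_def P_def prod.cartesian_product mult.assoc)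
    \<comment> \<open>The additive error becomes a relative one, because each of the
      \<open>t * s\<close> factors of \<open>P\<close> is at least \<open>r\<close>.\<close>
    also have "\<dots> \<le> \<delta> * P * M"
    proof (rule mult_right_mono)
      have "r ^ (t * s) = (\<Prod>i<t. \<Prod>j<s. r)" by (simp add: power_mult mult.commute)
      also have "\<dots> \<le> P"
        unfolding P_def using r r_le by (intro prod_mono conjI prod_nonneg) auto
      finally show "K * \<epsilon> \<le> \<delta> * P"
        using K\<epsilon> assms(1) by (meson mult_left_mono less_imp_le order.trans)
    qed (simp add: M_def)
    finally have "(1 - \<delta>) * M * P \<le> ?N"
      by (simp add: algebra_simps abs_le_iff)
    \<comment> \<open>Summing the indicators counts the pairs of transversals that read off
      \<open>C\<close>.\<close>
    also have "?N = real (card {(f, g). f \<in> ?F \<and> g \<in> ?G \<and> (\<forall>i<t. \<forall>j<s. A $$ (f i, g j) = C $$ (i, j))})"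
      unfolding real_card_pairs[OF finFG] by (intro sum.cong refl arg_cong[where f = of_bool]) auto
    also have "\<dots> \<le> real (num_submatrices C A)"
      using num_submatrices_ge_transversals[OF C bpD] by simp
    finally show "(1 - \<delta>) * (\<Prod>i<t. real (card (R i))) * (\<Prod>j<s. real (card (S j)))
          * (\<Prod>i<t. \<Prod>j<s. \<rho> i j (C $$ (i, j))) \<le> real (num_submatrices C A)"
      by (simp add: M_def P_def card_PiE mult.assoc)
  qed
qed

end
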